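(* There exist a finite sample space $\Omega$, probability mass functions $p^1,p^2,p^3,p^4$ over $\Omega$, and a function $d:\Omega\times\Omega\times\Omega\to\mathbb{R}$ such that $d$ is a $3$-metric on $\Omega$, but the associated multi-marginal optimal transport distances satisfy $$\mathcal{W}^{1,2,3} > \mathcal{W}^{1,2,4}+\mathcal{W}^{1,3,4}+\mathcal{W}^{2,3,4}.$$
   Context: A function $d:\Omega\times\Omega\times\Omega\to\mathbb{R}$ is a $3$-metric if for all $x,y,z,w\in\Omega$: (1) $d(x,y,z)\ge 0$; (2) $d(x,y,z)$ is invariant under all permutations of its arguments; (3) $d(x,y,z)=0$ if and only if $x=y=z$; (4) $d(x,y,z)\le d(y,z,w)+d(x,z,w)+d(x,y,w)$. For mass functions $p^i,p^j,p^k$ over $\Omega$, the multi-marginal optimal transport (MMOT) distance (with exponent $\ell=1$) associated with $d$ is $$\mathcal{W}^{i,j,k}=\min_{r}\ \sum_{x,y,z\in\Omega} d(x,y,z)\,r(x,y,z),$$ where the minimum is over all probability mass functions $r$ on $\Omega\times\Omega\times\Omega$ whose three univariate marginals are $p^i$, $p^j$ and $p^k$, in this order. *)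

theory Defs
  imports "HOL-Probability.Probability"
begin

definition three_metric_on :: "'a set \<Rightarrow> ('a \<Rightarrow> 'a \<Rightarrow> 'a \<Rightarrow> real) \<Rightarrow> bool" where
  "three_metric_on \<Omega> d \<longleftrightarrow>
     (\<forall>x\<in>\<Omega>. \<forall>y\<in>\<Omega>. \<forall>z\<in>\<Omega>. 0 \<le> d x y z) \<and>
     (\<forall>x\<in>\<Omega>. \<forall>y\<in>\<Omega>. \<forall>z\<in>\<Omega>.
        d x y z = d x z y \<and> d x y z = d y x z \<and> d x y z = d y z x \<and>
        d x y z = d z x y \<and> d x y z = d z y x) \<and>
     (\<forall>x\<in>\<Omega>. \<forall>y\<in>\<Omega>. \<forall>z\<in>\<Omega>. d x y z = 0 \<longleftrightarrow> x = y \<and> y = z) \<and>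
     (\<forall>x\<in>\<Omega>. \<forall>y\<in>\<Omega>. \<forall>z\<in>\<Omega>. \<forall>w\<in>\<Omega>.
        d x y z \<le> d y z w + d x z w + d x y w)"

definition mm_couplings ::
    "'a set \<Rightarrow> 'a pmf \<Rightarrow> 'a pmf \<Rightarrow> 'a pmf \<Rightarrow> ('a \<times> 'a \<times> 'a) pmf set" where
  "mm_couplings \<Omega> p q s =
     {r. set_pmf r \<subseteq> \<Omega> \<times> \<Omega> \<times> \<Omega> \<and>
         map_pmf (\<lambda>(x, y, z). x) r = p \<and>
         map_pmf (\<lambda>(x, y, z). y) r = q \<and>
         map_pmf (\<lambda>(x, y, z). z) r = s}"

definition transport_cost ::
    "'a set \<Rightarrow> ('a \<Rightarrow> 'a \<Rightarrow> 'a \<Rightarrow> real) \<Rightarrow> ('a \<times> 'a \<times> 'a) pmf \<Rightarrow> real" where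
  "transport_cost \<Omega> d r = (\<Sum>x\<in>\<Omega>. \<Sum>y\<in>\<Omega>. \<Sum>z\<in>\<Omega>. d x y z * pmf r (x, y, z))"

text \<open>The infimum below is a minimum for finite \<open>\<Omega>\<close> and mass functions on \<open>\<Omega>\<close>;
  see \<open>mmot_attained\<close>.\<close>

definition mmot ::
    "'a set \<Rightarrow> ('a \<Rightarrow> 'a \<Rightarrow> 'a \<Rightarrow> real) \<Rightarrow> 'a pmf \<Rightarrow> 'a pmf \<Rightarrow> 'a pmf \<Rightarrow> real" where
  "mmot \<Omega> d p q s = (INF r\<in>mm_couplings \<Omega> p q s. transport_cost \<Omega> d r)"

lemma mm_couplings_nonempty:
  assumes "set_pmf p \<subseteq> \<Omega>" "set_pmf q \<subseteq> \<Omega>" "set_pmf s \<subseteq> \<Omega>"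
  shows "mm_couplings \<Omega> p q s \<noteq> {}"
proof -
  let ?r = "pair_pmf p (pair_pmf q s)"
  have e: "(\<lambda>(x, y, z). x) = (fst :: 'a \<times> 'a \<times> 'a \<Rightarrow> 'a)"
    "(\<lambda>(x, y, z). y) = (fst \<circ> snd :: 'a \<times> 'a \<times> 'a \<Rightarrow> 'a)"
    "(\<lambda>(x, y, z). z) = (snd \<circ> snd :: 'a \<times> 'a \<times> 'a \<Rightarrow> 'a)"
    by auto
  have "?r \<in> mm_couplings \<Omega> p q s"
    using assms unfolding mm_couplings_def e
    by (auto simp: map_fst_pair_pmf map_snd_pair_pmf simp flip: pmf.map_comp)
  then show ?thesis by blast
qed

lemma marginal_sums:
  fixes r :: "('a \<times> 'a \<times> 'a) pmf"
  assumes fin: "finite \<Omega>" and sub: "set_pmf r \<subseteq> \<Omega> \<times> \<Omega> \<times> \<Omega>"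
  shows "pmf (map_pmf (\<lambda>(x, y, z). x) r) a = (if a \<in> \<Omega> then \<Sum>y\<in>\<Omega>. \<Sum>z\<in>\<Omega>. pmf r (a, y, z) else 0)" (is ?A)
    and "pmf (map_pmf (\<lambda>(x, y, z). y) r) a = (if a \<in> \<Omega> then \<Sum>x\<in>\<Omega>. \<Sum>z\<in>\<Omega>. pmf r (x, a, z) else 0)" (is ?B)
    and "pmf (map_pmf (\<lambda>(x, y, z). z) r) a = (if a \<in> \<Omega> then \<Sum>x\<in>\<Omega>. \<Sum>y\<in>\<Omega>. pmf r (x, y, a) else 0)" (is ?C)
proof -
  have key: "pmf (map_pmf g r) a = (\<Sum>t\<in>{t \<in> \<Omega> \<times> \<Omega> \<times> \<Omega>. g t = a}. pmf r t)" for g :: "'a \<times> 'a \<times> 'a \<Rightarrow> 'a"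
  proof -
    have "pmf (map_pmf g r) a = measure_pmf.prob r (g -` {a})"
      by (simp add: pmf_map)
    also have "\<dots> = measure_pmf.prob r {t \<in> \<Omega> \<times> \<Omega> \<times> \<Omega>. g t = a}"
      using sub by (intro measure_pmf.finite_measure_eq_AE) (auto simp: AE_measure_pmf_iff)
    also have "\<dots> = (\<Sum>t\<in>{t \<in> \<Omega> \<times> \<Omega> \<times> \<Omega>. g t = a}. pmf r t)"
      using fin by (intro measure_measure_pmf_finite) auto
    finally show ?thesis .
  qed
  have prod3: "(\<Sum>t\<in>X \<times> Y \<times> Z. pmf r t) = (\<Sum>x\<in>X. \<Sum>y\<in>Y. \<Sum>z\<in>Z. pmf r (x, y, z))" for X Y Z
    by (simp add: sum.cartesian_product case_prod_unfold)
  have A: "{t \<in> \<Omega> \<times> \<Omega> \<times> \<Omega>. (\<lambda>(x, y, z). x) t = a} = (if a \<in> \<Omega> then {a} \<times> \<Omega> \<times> \<Omega> else {})"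
    and B: "{t \<in> \<Omega> \<times> \<Omega> \<times> \<Omega>. (\<lambda>(x, y, z). y) t = a} = (if a \<in> \<Omega> then \<Omega> \<times> {a} \<times> \<Omega> else {})"
    and C: "{t \<in> \<Omega> \<times> \<Omega> \<times> \<Omega>. (\<lambda>(x, y, z). z) t = a} = (if a \<in> \<Omega> then \<Omega> \<times> \<Omega> \<times> {a} else {})"
    by auto
  show ?A unfolding key A by (simp only: prod3 if_distrib) (simp add: prod3)
  show ?B unfolding key B by (simp only: prod3 if_distrib) (simp add: prod3)
  show ?C unfolding key C by (simp only: prod3 if_distrib) (simp add: prod3)
qed

lemma mmot_attained:
  fixes d :: "'a \<Rightarrow> 'a \<Rightarrow> 'a \<Rightarrow> real"
  assumes fin: "finite \<Omega>"
    and p: "set_pmf p \<subseteq> \<Omega>" and q: "set_pmf q \<subseteq> \<Omega>" and s: "set_pmf s \<subseteq> \<Omega>"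
  shows "\<exists>r\<in>mm_couplings \<Omega> p q s. mmot \<Omega> d p q s = transport_cost \<Omega> d r \<and>
           (\<forall>r'\<in>mm_couplings \<Omega> p q s. transport_cost \<Omega> d r \<le> transport_cost \<Omega> d r')"
proof -
  define S where "S = \<Omega> \<times> \<Omega> \<times> \<Omega>"
  have finS: "finite S" using fin by (simp add: S_def)
  define B :: "('a \<times> 'a \<times> 'a \<Rightarrow> real) set"
    where "B = PiE UNIV (\<lambda>t. if t \<in> S then {0..1} else {0})"
  define M where "M = {f :: 'a \<times> 'a \<times> 'a \<Rightarrow> real. \<forall>a\<in>\<Omega>.
      (\<Sum>y\<in>\<Omega>. \<Sum>z\<in>\<Omega>. f (a, y, z)) = pmf p a \<and>
      (\<Sum>x\<in>\<Omega>. \<Sum>z\<in>\<Omega>. f (x, a, z)) = pmf q a \<and>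
      (\<Sum>x\<in>\<Omega>. \<Sum>y\<in>\<Omega>. f (x, y, a)) = pmf s a}"
  define c where "c f = (\<Sum>x\<in>\<Omega>. \<Sum>y\<in>\<Omega>. \<Sum>z\<in>\<Omega>. d x y z * f (x, y, z))"
    for f :: "'a \<times> 'a \<times> 'a \<Rightarrow> real"
  have ev: "continuous_on UNIV (\<lambda>f :: 'a \<times> 'a \<times> 'a \<Rightarrow> real. f t)" for t
    by (rule continuous_on_product_coordinates)
  have "compactin (product_topology (\<lambda>_. euclidean) UNIV) B"
    unfolding B_def compactin_PiE by auto
  then have "compact B"
    by (simp add: euclidean_product_topology)
  moreover have "closed M"
  proof -
    have "M = (\<Inter>a\<in>\<Omega>. {f. (\<Sum>y\<in>\<Omega>. \<Sum>z\<in>\<Omega>. f (a, y, z)) = pmf p a \<and>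
        (\<Sum>x\<in>\<Omega>. \<Sum>z\<in>\<Omega>. f (x, a, z)) = pmf q a \<and>
        (\<Sum>x\<in>\<Omega>. \<Sum>y\<in>\<Omega>. f (x, y, a)) = pmf s a})"
      by (auto simp: M_def)
    then show ?thesis
      by (auto intro!: closed_INT closed_Collect_conj closed_Collect_eq continuous_on_sum ev)
  qed
  ultimately have cpt: "compact (B \<inter> M)" by (rule compact_Int_closed)
  have img: "pmf ` mm_couplings \<Omega> p q s = B \<inter> M"
  proof (intro equalityI subsetI)
    fix f assume "f \<in> pmf ` mm_couplings \<Omega> p q s"
    then obtain r where f: "f = pmf r" and r: "r \<in> mm_couplings \<Omega> p q s" by auto
    have sub: "set_pmf r \<subseteq> \<Omega> \<times> \<Omega> \<times> \<Omega>" using r by (simp add: mm_couplings_def)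
    have "pmf r t = 0" if "t \<notin> S" for t
      using sub that by (auto simp: S_def set_pmf_iff)
    then have "f \<in> B"
      unfolding B_def f by (auto simp: PiE_iff pmf_le_1)
    moreover have "f \<in> M"
    proof -
      have "pmf (map_pmf (\<lambda>(x, y, z). x) r) = pmf p" "pmf (map_pmf (\<lambda>(x, y, z). y) r) = pmf q"
        "pmf (map_pmf (\<lambda>(x, y, z). z) r) = pmf s"
        using r by (auto simp: mm_couplings_def)
      then show ?thesis
        unfolding M_def f fun_eq_iff marginal_sums[OF fin sub] mem_Collect_eq
        by (intro ballI conjI) (auto dest!: spec split: if_splits)
    qed
    ultimately show "f \<in> B \<inter> M" by blast
  next
    fix f assume f: "f \<in> B \<inter> M"
    have nn: "0 \<le> f t" and z: "t \<notin> S \<Longrightarrow> f t = 0" for t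
    proof -
      have m: "f t \<in> (if t \<in> S then {0..1} else {0})"
        using f unfolding B_def PiE_iff by blast
      then show "0 \<le> f t" by (simp split: if_splits)
      show "t \<notin> S \<Longrightarrow> f t = 0" using m by simp
    qed
    have "(\<Sum>t\<in>S. f t) = (\<Sum>x\<in>\<Omega>. \<Sum>y\<in>\<Omega>. \<Sum>z\<in>\<Omega>. f (x, y, z))"
      unfolding S_def by (simp add: sum.cartesian_product)
    also have "\<dots> = (\<Sum>x\<in>\<Omega>. pmf p x)"
      using f by (auto simp: M_def intro!: sum.cong)
    also have "\<dots> = 1"
      using fin p by (rule sum_pmf_eq_1)
    finally have tot: "(\<Sum>t\<in>S. f t) = 1" .
    have "(\<integral>\<^sup>+t. ennreal (f t) \<partial>count_space UNIV) = (\<Sum>t\<in>S. ennreal (f t))"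
      using finS z by (intro nn_integral_count_space') auto
    also have "\<dots> = ennreal (\<Sum>t\<in>S. f t)" by (intro sum_ennreal nn)
    finally have pf: "pmf (embed_pmf f) = f"
      using nn tot by (intro ext pmf_embed_pmf) auto
    define r where "r = embed_pmf f"
    have rf: "pmf r = f" using pf by (simp add: r_def)
    have sub: "set_pmf r \<subseteq> \<Omega> \<times> \<Omega> \<times> \<Omega>"
      using z unfolding S_def[symmetric] by (metis rf set_pmf_iff subsetI)
    have z': "a \<notin> \<Omega> \<Longrightarrow> pmf p a = 0" "a \<notin> \<Omega> \<Longrightarrow> pmf q a = 0" "a \<notin> \<Omega> \<Longrightarrow> pmf s a = 0" for a
      using p q s by (auto simp: set_pmf_iff)
    have "r \<in> mm_couplings \<Omega> p q s"
      unfolding mm_couplings_def using sub f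
      by (auto intro!: pmf_eqI simp: marginal_sums[OF fin sub] rf M_def z')
    then show "f \<in> pmf ` mm_couplings \<Omega> p q s"
      using rf by blast
  qed
  have "continuous_on (B \<inter> M) c"
    unfolding c_def
    by (intro continuous_on_sum continuous_on_mult continuous_on_const
        continuous_on_subset[OF ev]) auto
  moreover have "B \<inter> M \<noteq> {}"
    using mm_couplings_nonempty[OF p q s] img by blast
  ultimately obtain f where f: "f \<in> B \<inter> M" and le: "\<And>g. g \<in> B \<inter> M \<Longrightarrow> c f \<le> c g"
    using continuous_attains_inf[OF cpt] by blast
  have cost: "transport_cost \<Omega> d r = c (pmf r)" for r
    by (simp add: transport_cost_def c_def)
  obtain r where r: "r \<in> mm_couplings \<Omega> p q s" "f = pmf r"
    using f img by blast
  have min: "\<forall>r'\<in>mm_couplings \<Omega> p q s. transport_cost \<Omega> d r \<le> transport_cost \<Omega> d r'"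
    using le img r by (auto simp: cost)
  have "mmot \<Omega> d p q s = transport_cost \<Omega> d r"
    unfolding mmot_def using r min by (intro cInf_eq_minimum) auto
  with r min show ?thesis by blast
qed

end

theory Submission
  imports Defs
begin

text \<open>Take for \<open>p4\<close> a point mass at the apex of a cone over a 6-cycle, and give the triples
  consisting of the apex and an edge the cost 1, all other nonconstant triples the cost 4. As the cycle has
  no triangle, no four points have exactly one face of cost 4, so this is a 3-metric. Let
  \<open>p1\<close>, \<open>p2\<close>, \<open>p3\<close> be uniform on the three pairs of antipodal vertices of the cycle. Any two of
  them can be matched along edges, so each distance involving \<open>p4\<close> is at most 1; but no triple
  charged by a coupling of \<open>p1\<close>, \<open>p2\<close>, \<open>p3\<close> contains the apex, so every such coupling costs 4.\<close>

definition cone_metric :: "('a \<Rightarrow> 'a \<Rightarrow> bool) \<Rightarrow> 'a \<Rightarrow> 'a \<Rightarrow> 'a \<Rightarrow> 'a \<Rightarrow> real" where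
  "cone_metric E w x y z =
     (if x = y \<and> y = z then 0
      else if x = w \<and> E y z \<or> y = w \<and> E x z \<or> z = w \<and> E x y then 1
      else 4)"

text \<open>One right-hand term equal to the maximal value 4 settles the last axiom; otherwise the
  left-hand side vanishes.\<close>

lemma three_metric_on_cone_metric:
  assumes sym: "\<And>x y. E x y \<Longrightarrow> E y x"
    and irrefl: "\<And>x. \<not> E x x"
    and apex: "\<And>x. \<not> E x w"
    and triangle_free: "\<And>x y z. E x y \<Longrightarrow> E y z \<Longrightarrow> \<not> E x z"
  shows "three_metric_on \<Omega> (cone_metric E w)"
proof -
  let ?d = "cone_metric E w"
  have comm: "E x y \<longleftrightarrow> E y x" for x y
    using sym by blast
  have apex': "\<not> E w x" for x
    using sym apex by blast
  have nonneg: "0 \<le> ?d x y z" and le: "?d x y z \<le> 4" for x y z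
    by (simp_all add: cone_metric_def)
  have quad: "?d x y z \<le> ?d y z v + ?d x z v + ?d x y v" for x y z v
  proof (cases "?d y z v = 4 \<or> ?d x z v = 4 \<or> ?d x y v = 4")
    case True
    then show ?thesis
      using le[of x y z] nonneg[of y z v] nonneg[of x z v] nonneg[of x y v] by linarith
  next
    case False
    then have "(y = z \<and> z = v) \<or> y = w \<and> E z v \<or> z = w \<and> E y v \<or> v = w \<and> E y z"
      "(x = z \<and> z = v) \<or> x = w \<and> E z v \<or> z = w \<and> E x v \<or> v = w \<and> E x z"
      "(x = y \<and> y = v) \<or> x = w \<and> E y v \<or> y = w \<and> E x v \<or> v = w \<and> E x y"
      by (auto simp: cone_metric_def split: if_splits)
    \<comment> \<open>A face of cost 1 contains the apex exactly once. If all three have cost 1, the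
      apex is \<open>v\<close>: otherwise it would be two of \<open>x\<close>, \<open>y\<close>,
      \<open>z\<close> and occur twice in one face. Then \<open>x\<close>, \<open>y\<close>,
      \<open>z\<close> form a triangle. If one face is constant, irreflexivity makes the others
      constant too.\<close>
    then have "x = y \<and> y = z"
      using comm by (auto simp: irrefl apex apex' dest: triangle_free)
    then show ?thesis
      using nonneg[of y z v] nonneg[of x z v] nonneg[of x y v]
      by (simp add: cone_metric_def)
  qed
  show ?thesis
    unfolding three_metric_on_def
    using nonneg quad by (auto simp: cone_metric_def comm)
qed

lemma transport_cost_const:
  assumes "finite \<Omega>" and sub: "set_pmf r \<subseteq> \<Omega> \<times> \<Omega> \<times> \<Omega>"
    and const: "\<And>x y z. (x, y, z) \<in> set_pmf r \<Longrightarrow> d x y z = c"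
  shows "transport_cost \<Omega> d r = c"
proof -
  have eq: "d x y z * pmf r (x, y, z) = c * pmf r (x, y, z)" for x y z
    using const[of x y z] by (cases "(x, y, z) \<in> set_pmf r") (auto simp: set_pmf_iff)
  have "transport_cost \<Omega> d r = c * (\<Sum>t\<in>\<Omega> \<times> \<Omega> \<times> \<Omega>. pmf r t)"
    unfolding transport_cost_def eq
    by (simp add: sum_distrib_left sum.cartesian_product case_prod_unfold)
  then show ?thesis
    using assms by (simp add: sum_pmf_eq_1)
qed

text \<open>Triples charged by a coupling have their coordinates in the supports of the marginals,
  so all couplings cost the same.\<close>

lemma mmot_const:
  assumes "finite \<Omega>" "set_pmf p \<subseteq> \<Omega>" "set_pmf q \<subseteq> \<Omega>" "set_pmf s \<subseteq> \<Omega>"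
    and const: "\<And>x y z. x \<in> set_pmf p \<Longrightarrow> y \<in> set_pmf q \<Longrightarrow> z \<in> set_pmf s \<Longrightarrow> d x y z = c"
  shows "mmot \<Omega> d p q s = c"
proof -
  obtain r where r: "r \<in> mm_couplings \<Omega> p q s" "mmot \<Omega> d p q s = transport_cost \<Omega> d r"
    using mmot_attained assms(1-4) by metis
  then have "set_pmf p = (\<lambda>(x, y, z). x) ` set_pmf r" "set_pmf q = (\<lambda>(x, y, z). y) ` set_pmf r"
    "set_pmf s = (\<lambda>(x, y, z). z) ` set_pmf r"
    by (auto simp: mm_couplings_def simp flip: set_map_pmf)
  then have "d x y z = c" if "(x, y, z) \<in> set_pmf r" for x y z
    using that by (intro const) force+
  then show ?thesis
    using r assms(1) transport_cost_const[of \<Omega> r d c] by (simp add: mm_couplings_def)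
qed

text \<open>Pushing \<open>p\<close> forward along the graph of \<open>f\<close> gives a coupling of
  cost \<open>c\<close>.\<close>

lemma mmot_le_map_return:
  assumes "finite \<Omega>" "set_pmf p \<subseteq> \<Omega>" "f ` set_pmf p \<subseteq> \<Omega>" "w \<in> \<Omega>"
    and const: "\<And>x. x \<in> set_pmf p \<Longrightarrow> d x (f x) w = c"
  shows "mmot \<Omega> d p (map_pmf f p) (return_pmf w) \<le> c"
proof -
  define r where "r = map_pmf (\<lambda>x. (x, f x, w)) p"
  have r: "r \<in> mm_couplings \<Omega> p (map_pmf f p) (return_pmf w)"
    using assms by (auto simp: mm_couplings_def r_def pmf.map_comp o_def)
  have "mmot \<Omega> d p (map_pmf f p) (return_pmf w) \<le> transport_cost \<Omega> d r"
    using mmot_attained[of \<Omega> p "map_pmf f p" "return_pmf w" d] assms r by auto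
  also have "\<dots> = c"
    using assms r by (intro transport_cost_const) (auto simp: mm_couplings_def r_def)
  finally show ?thesis .
qed

definition hexagon :: "nat \<Rightarrow> nat \<Rightarrow> bool" where
  \<comment> \<open>The bounds keep the apex \<open>6\<close> isolated, since
    \<open>Suc 6 mod 6 = 1\<close>.\<close>
  "hexagon x y \<longleftrightarrow> x < 6 \<and> y < 6 \<and> (y = Suc x mod 6 \<or> x = Suc y mod 6)"

text \<open>Reduction modulo the even number 6 preserves parity. This 2-colouring excludes loops and
  triangles at once.\<close>

lemma hexagon_bipartite:
  assumes "hexagon x y"
  shows "even x \<noteq> even y"
  using assms by (auto simp: hexagon_def dvd_mod_iff)

theorem theorem2:
  shows "\<exists>(\<Omega> :: nat set) (p1 :: nat pmf) (p2 :: nat pmf) (p3 :: nat pmf) (p4 :: nat pmf)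
           (d :: nat \<Rightarrow> nat \<Rightarrow> nat \<Rightarrow> real).
           finite \<Omega> \<and>
           set_pmf p1 \<subseteq> \<Omega> \<and> set_pmf p2 \<subseteq> \<Omega> \<and> set_pmf p3 \<subseteq> \<Omega> \<and> set_pmf p4 \<subseteq> \<Omega> \<and>
           three_metric_on \<Omega> d \<and>
           mmot \<Omega> d p1 p2 p3 > mmot \<Omega> d p1 p2 p4 + mmot \<Omega> d p1 p3 p4 + mmot \<Omega> d p2 p3 p4"
proof -
  define \<Omega> :: "nat set" where "\<Omega> = {..6}"
  define p1 :: "nat pmf" where "p1 = pmf_of_set {0, 3}"
  define p2 :: "nat pmf" where "p2 = pmf_of_set {1, 4}"
  define p3 :: "nat pmf" where "p3 = pmf_of_set {2, 5}"
  define p4 :: "nat pmf" where "p4 = return_pmf 6"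
  define d where "d = cone_metric hexagon 6"
  have set1: "set_pmf p1 = {0, 3}" and set2: "set_pmf p2 = {1, 4}" and set3: "set_pmf p3 = {2, 5}"
    by (simp_all add: p1_def p2_def p3_def)
  have fin: "finite \<Omega>" and sub: "set_pmf p1 \<subseteq> \<Omega>" "set_pmf p2 \<subseteq> \<Omega>" "set_pmf p3 \<subseteq> \<Omega>" "set_pmf p4 \<subseteq> \<Omega>"
    by (auto simp: \<Omega>_def set1 set2 set3 p4_def)
  have metric: "three_metric_on \<Omega> d"
    unfolding d_def
  proof (rule three_metric_on_cone_metric)
    show "\<not> hexagon x x" "hexagon x y \<Longrightarrow> hexagon y z \<Longrightarrow> \<not> hexagon x z" for x y z
      using hexagon_bipartite by blast+
  qed (auto simp: hexagon_def)
  have p2_eq: "p2 = map_pmf Suc p1"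
    unfolding p1_def p2_def by (subst map_pmf_of_set_inj) auto
  have p3_eq: "p3 = map_pmf Suc p2"
    unfolding p2_def p3_def by (subst map_pmf_of_set_inj) (auto simp: numeral_eq_Suc)
  \<comment> \<open>The map is the predecessor on the cycle: 0 goes to 5 and 3 to 2.\<close>
  have p3_eq': "p3 = map_pmf (\<lambda>x. (x + 5) mod 6) p1"
    unfolding p1_def p3_def by (subst map_pmf_of_set_inj) (auto simp: insert_commute)
  \<comment> \<open>The supports are pairwise disjoint, so no charged triple is constant
    either.\<close>
  have "mmot \<Omega> d p1 p2 p3 = 4"
    using fin sub(1-3)
    by (rule mmot_const) (auto simp: set1 set2 set3 d_def cone_metric_def)
  moreover have "mmot \<Omega> d p1 p2 p4 \<le> 1"
    unfolding p2_eq p4_def using fin sub(1)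
    by (rule mmot_le_map_return) (auto simp: set1 \<Omega>_def d_def cone_metric_def hexagon_def)
  moreover have "mmot \<Omega> d p1 p3 p4 \<le> 1"
    unfolding p3_eq' p4_def using fin sub(1)
    by (rule mmot_le_map_return) (auto simp: set1 \<Omega>_def d_def cone_metric_def hexagon_def)
  moreover have "mmot \<Omega> d p2 p3 p4 \<le> 1"
    unfolding p3_eq p4_def using fin sub(2)
    by (rule mmot_le_map_return) (auto simp: set2 \<Omega>_def d_def cone_metric_def hexagon_def)
  ultimately have "mmot \<Omega> d p1 p2 p3 > mmot \<Omega> d p1 p2 p4 + mmot \<Omega> d p1 p3 p4 + mmot \<Omega> d p2 p3 p4"
    by linarith
  with fin sub metric show ?thesis
    by blast
qed

end
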